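(* Let $w=\frac{az+b}{cz+d}$ be a PLFT with $c\neq0$ and $d\neq 0$. Let $k\ge1$, let $q_0$ be a nonnegative integer, and let $q_1,\dots,q_{k-1}$ be positive integers. Then the following are equivalent. (a) There exist nonnegative integers $a',b',c',d'$ with $a'd'-b'c'\neq0$ and $c'\neq 0$ such that $$w = q_0+\cfrac{1}{q_1+\cfrac{1}{\ddots+\cfrac{1}{q_{k-1}+\frac{a'z+b'}{c'z+d'}}}}$$ as PLFTs. (b) Both of the following hold. - There exist nonnegative integers $a'',c''$ with $c''\neq0$ and $\gcd(a'',c'')=1$ such that $$\frac{a}{c}= q_0+\cfrac{1}{q_1+\cfrac{1}{\ddots+\cfrac{1}{q_{k-1}+\frac{a''}{c''}}}}.$$ - Either there exist nonnegative integers $b'',d''$ with $d''\neq 0$ and $\gcd(b'',d'')=1$ such that $$\frac{b}{d}= q_0+\cfrac{1}{q_1+\cfrac{1}{\ddots+\cfrac{1}{q_{k-1}+\frac{b''}{d''}}}},$$ or else $k\ge2$ and $$\frac{b}{d}=q_0+\cfrac{1}{q_1+\cfrac{1}{\ddots+\cfrac{1}{q_{k-2}}}}.$$ (c) There exist nonnegative integers $a',b',c',d'$ with $a'd'-b'c'\neq0$ and $c'\neq 0$ such that $$\begin{bmatrix}a&b\\c&d\end{bmatrix}=R_1^{q_0}L_1^{q_1}R_1^{q_2}\cdots X^{q_{k-1}}\begin{bmatrix}a'&b'\\c'&d'\end{bmatrix},$$ where the factors alternate between powers of $R_1$ and $L_1$, starting with $R_1^{q_0}$, and $X=R_1$ if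 $k$ is odd and $X=L_1$ if $k$ is even.
   Context: A positive linear fractional transformation (PLFT) is $\frac{az+b}{cz+d}$ with $a,b,c,d$ nonnegative integers and $ad-bc\neq0$. PLFTs are identified with their coefficient matrices $\begin{bmatrix}a&b\\c&d\end{bmatrix}$ in $GL_2(\mathbb{N}_0)$; under this identification composition corresponds to matrix multiplication. Accordingly, expressions built from a PLFT $f$ with matrix $M$ are computed at the level of coefficient matrices: - $q+f$ (for a nonnegative integer $q$) has matrix $R_1^qM$; - $1/f$ has the matrix obtained from $M$ by swapping its two rows. Equality "as PLFTs" means equality of the resulting coefficient matrices. The matrices used are $$L_1=\begin{bmatrix}1&0\\1&1\end{bmatrix},\qquad R_1=\begin{bmatrix}1&1\\0&1\end{bmatrix}.$$ The displayed expressions are not required to be continued fraction expansions in the usual sense.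
   Formalization: In (c), for even k the condition c' ≠ 0 is replaced by a' ≠ 0 (odd k unchanged), since the stated equivalence fails for even k: with k=2, q_0=0, q_1=1, w=z/(z+1), (a) holds but (c) forces the identity tail, so c'=0. *)

theory Defs
  imports "HOL-Analysis.Analysis"
begin

definition mat2 :: "nat \<Rightarrow> nat \<Rightarrow> nat \<Rightarrow> nat \<Rightarrow> nat^2^2" where
  "mat2 a b c d = vector [vector [a, b], vector [c, d]]"

(* Coefficients are natural numbers, so nonnegativity is built into the type; the
   determinant is computed in the integers because subtraction on nat truncates.
   A PLFT is identified with its coefficient matrix (not up to scaling). *)
definition plft :: "nat^2^2 \<Rightarrow> bool" where
  "plft M \<longleftrightarrow> int (M$1$1) * int (M$2$2) - int (M$1$2) * int (M$2$1) \<noteq> 0"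

definition L1 :: "nat^2^2" where "L1 = mat2 1 0 1 1"
definition R1 :: "nat^2^2" where "R1 = mat2 1 1 0 1"

(* Power with respect to the matrix product **; the overloaded operations * and ^ on
   the vector type are componentwise. *)
definition mat_pow :: "nat^2^2 \<Rightarrow> nat \<Rightarrow> nat^2^2" where
  "mat_pow A n = (((**) A) ^^ n) (mat 1)"

(* matrix of q + f *)
definition plft_add :: "nat \<Rightarrow> nat^2^2 \<Rightarrow> nat^2^2" where
  "plft_add q M = mat_pow R1 q ** M"

(* matrix of 1/f: the two rows are swapped *)
definition plft_recip :: "nat^2^2 \<Rightarrow> nat^2^2" where
  "plft_recip M = vector [M$2, M$1]"

(* plft_cf [q_0, ..., q_{k-1}] f is q_0 + 1/(q_1 + 1/(... + 1/(q_{k-1} + f))), computed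
   on matrices. The equation for [] is a dummy. *)
fun plft_cf :: "nat list \<Rightarrow> nat^2^2 \<Rightarrow> nat^2^2" where
  "plft_cf [] M = M"
| "plft_cf [q] M = plft_add q M"
| "plft_cf (q # r # qs) M = plft_add q (plft_recip (plft_cf (r # qs) M))"

(* num_cf [q_0, ..., q_{k-1}] x is q_0 + 1/(q_1 + 1/(... + 1/(q_{k-1} + x))). For x \<ge> 0
   and q_1, ..., q_{k-1} positive no denominator vanishes. The equation for [] is a dummy. *)
fun num_cf :: "nat list \<Rightarrow> rat \<Rightarrow> rat" where
  "num_cf [] x = x"
| "num_cf [q] x = of_nat q + x"
| "num_cf (q # r # qs) x = of_nat q + 1 / num_cf (r # qs) x"

(* finite_cf [q_0, ..., q_m] is q_0 + 1/(q_1 + 1/(... + 1/q_m)) *)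
fun finite_cf :: "nat list \<Rightarrow> rat" where
  "finite_cf [] = 0"
| "finite_cf [q] = of_nat q"
| "finite_cf (q # r # qs) = of_nat q + 1 / finite_cf (r # qs)"

(* RL_word [q_0, ..., q_{k-1}] = R1^{q_0} L1^{q_1} R1^{q_2} ... *)
definition RL_word :: "nat list \<Rightarrow> nat^2^2" where
  "RL_word qs =
     foldr (**) (map (\<lambda>i. mat_pow (if even i then R1 else L1) (qs ! i)) [0..<length qs]) (mat 1)"

lemmas mat2_eval =
  mat2_def L1_def R1_def mat_pow_def plft_add_def plft_recip_def RL_word_def plft_def
  matrix_matrix_mult_def mat_def vec_eq_iff forall_2 sum_2

(* Nondegeneracy of the tail matrix (a' b'; c' d') of an RL-word of length k: passing from
   the expansion to the word uses 1/(q + f) = L1^q (1/f), so this is the matrix of the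
   tail f of the expansion for odd k, but the row-swapped one, of 1/f, for even k. The
   condition that f has a nonzero lower left entry is therefore c' \<noteq> 0 for odd k
   and a' \<noteq> 0 for even k. Requiring c' \<noteq> 0 for all k would not be equivalent to
   the expansion: here w = z/(z+1) = 0 + 1/(1 + 1/z), with k = 2. *)
lemma tail_condition_even_example:
  "plft (mat2 1 0 1 1)"
  "plft (mat2 0 1 1 0)"
  "mat2 1 0 1 1 = plft_cf [0, 1] (mat2 0 1 1 0)"
  "mat2 1 0 1 1 = RL_word [0, 1] ** mat2 a' b' c' d' \<Longrightarrow> c' = 0"
  by (auto simp: mat2_eval)

end

(* The expansion acts on each column of the coefficient matrix separately, by a unimodular
   linear map whose effect on the ratio of the two entries is the numerical continued fraction.
   A fraction determines its column up to the factor gcd of the entries, and that factor can be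
   moved into the tail because the action is linear; so A is B read column by column. The
   exceptional case of B is the column (1, 0), that is, the tail value infinity. For C, the row
   swap S satisfies S R1^n S = L1^n, so pushing all the swaps to the right turns the expansion
   into the alternating word, with one swap left over for even length. *)
theory Submission
  imports Defs
begin

text \<open>The pair (x, y) stands for the fraction x/y without cancelling common factors. Lower
  entry 0 encodes the value infinity, which \<open>rat\<close> lacks.\<close>

fun cf_col :: "nat list \<Rightarrow> nat \<times> nat \<Rightarrow> nat \<times> nat" where
  "cf_col [] v = v"
| "cf_col [q] v = (fst v + q * snd v, snd v)"
| "cf_col (q # r # qs) v = (let (x, y) = cf_col (r # qs) v in (y + q * x, x))"

section \<open>Coefficient matrices in coordinates\<close>

lemma mat2_nth [simp]:
  "mat2 a b c d $ 1 $ 1 = a" "mat2 a b c d $ 1 $ 2 = b"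
  "mat2 a b c d $ 2 $ 1 = c" "mat2 a b c d $ 2 $ 2 = d"
  by (simp_all add: mat2_def)

lemma mat2_eq_iff [simp]:
  "mat2 a b c d = mat2 a' b' c' d' \<longleftrightarrow> a = a' \<and> b = b' \<and> c = c' \<and> d = d'"
  by (auto simp: mat2_eval)

lemma mat2_exhaust:
  obtains a b c d where "M = mat2 a b c d"
proof
  show "M = mat2 (M$1$1) (M$1$2) (M$2$1) (M$2$2)"
    by (simp add: mat2_eval)
qed

lemma mat2_mult:
  "mat2 a b c d ** mat2 a' b' c' d' =
     mat2 (a * a' + b * c') (a * b' + b * d') (c * a' + d * c') (c * b' + d * d')"
  by (simp add: mat2_eval)

lemma mat_1_eq_mat2: "mat 1 = mat2 1 0 0 1"
  by (simp add: mat2_eval)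

lemma mat_pow_R1: "mat_pow R1 n = mat2 1 n 0 1"
  by (induction n) (simp_all add: mat_pow_def mat_1_eq_mat2 R1_def mat2_mult del: One_nat_def)

lemma mat_pow_L1: "mat_pow L1 n = mat2 1 0 n 1"
  by (induction n) (simp_all add: mat_pow_def mat_1_eq_mat2 L1_def mat2_mult del: One_nat_def)

lemma plft_add_mat2: "plft_add n (mat2 a b c d) = mat2 (a + n * c) (b + n * d) c d"
  by (simp add: plft_add_def mat_pow_R1 mat2_mult)

lemma plft_recip_mat2: "plft_recip (mat2 a b c d) = mat2 c d a b"
  by (simp add: plft_recip_def mat2_def)

lemma plft_mat2: "plft (mat2 a b c d) \<longleftrightarrow> a * d \<noteq> b * c"
  unfolding plft_def by (simp flip: of_nat_mult)

lemma plft_cf_mat2: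
  "plft_cf qs (mat2 a b c d) =
     mat2 (fst (cf_col qs (a, c))) (fst (cf_col qs (b, d)))
          (snd (cf_col qs (a, c))) (snd (cf_col qs (b, d)))"
  by (induction qs "(a, c)" rule: cf_col.induct)
     (auto simp: plft_add_mat2 plft_recip_mat2 split: prod.splits)

text \<open>Adding q preserves the determinant, and taking a reciprocal negates it.\<close>

lemma plft_plft_cf: "plft (plft_cf qs M) \<longleftrightarrow> plft M"
proof (induction qs M rule: plft_cf.induct)
  case (2 n M)
  then show ?case
    by (cases M rule: mat2_exhaust) (simp add: plft_add_mat2 plft_mat2 algebra_simps)
next
  case (3 n r qs M)
  then show ?case
    by (cases "plft_cf (r # qs) M" rule: mat2_exhaust)
       (auto simp: plft_add_mat2 plft_recip_mat2 plft_mat2 algebra_simps)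
qed simp

section \<open>The column action: scaling, gcd and ratio\<close>

lemma cf_col_scale: "cf_col qs (g * x, g * y) = map_prod ((*) g) ((*) g) (cf_col qs (x, y))"
  by (induction qs "(x, y)" rule: cf_col.induct) (auto simp: algebra_simps split: prod.splits)

text \<open>Each step is a step of the Euclidean algorithm run backwards.\<close>

lemma gcd_cf_col: "gcd (fst (cf_col qs v)) (snd (cf_col qs v)) = gcd (fst v) (snd v)"
proof (induction qs v rule: cf_col.induct)
  case (2 n v)
  then show ?case
    by (metis cf_col.simps(2) fst_conv snd_conv gcd.commute gcd_add_mult add.commute)
next
  case (3 n r qs v)
  then show ?case
    by (auto simp: gcd.commute split: prod.splits)
       (metis gcd_add_mult add.commute gcd.commute)
qed simp

text \<open>The clause on \<open>hd qs\<close> strengthens the induction: the upper entry for the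
  shorter list becomes the denominator of the next step, and the head of that list is
  positive.\<close>

lemma cf_col_ratio:
  assumes "qs \<noteq> []" "\<forall>n \<in> set (tl qs). n > 0" "snd v \<noteq> 0"
  shows "snd (cf_col qs v) \<noteq> 0 \<and> (hd qs > 0 \<longrightarrow> fst (cf_col qs v) \<noteq> 0) \<and>
    of_nat (fst (cf_col qs v)) / of_nat (snd (cf_col qs v)) =
      num_cf qs (of_nat (fst v) / of_nat (snd v))"
  using assms
proof (induction qs v rule: cf_col.induct)
  case (2 n v)
  then show ?case by (simp add: field_simps)
next
  case (3 n r qs v)
  obtain x y where "cf_col (r # qs) v = (x, y)" by fastforce
  moreover from this 3 have "x \<noteq> 0" "y \<noteq> 0"
    and "num_cf (r # qs) (of_nat (fst v) / of_nat (snd v)) = of_nat x / of_nat y"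
    by auto
  ultimately show ?case by (simp add: add_divide_distrib)
qed simp

text \<open>The tail infinity absorbs the last quotient, whose reciprocal term then vanishes; the
  fraction therefore ends one quotient earlier.\<close>

lemma cf_col_infinity:
  assumes "length qs \<ge> 2" "\<forall>n \<in> set (tl qs). n > 0"
  shows "snd (cf_col qs (1, 0)) \<noteq> 0 \<and> (hd qs > 0 \<longrightarrow> fst (cf_col qs (1, 0)) \<noteq> 0) \<and>
    of_nat (fst (cf_col qs (1, 0))) / of_nat (snd (cf_col qs (1, 0))) = finite_cf (butlast qs)"
  using assms
proof (induction qs "(1, 0) :: nat \<times> nat" rule: cf_col.induct)
  case (3 n r qs)
  show ?case
  \<comment> \<open>The induction hypothesis needs two quotients in \<open>r # qs\<close>; if there
    is only one, the column is (n, 1) by direct computation.\<close>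
  proof (cases qs)
    case (Cons s ss)
    obtain x y where "cf_col (r # qs) (1, 0) = (x, y)" by fastforce
    moreover from this 3 Cons have "x \<noteq> 0" "y \<noteq> 0"
      and "finite_cf (butlast (r # qs)) = of_nat x / of_nat y"
      by auto
    moreover have "finite_cf (butlast (n # r # qs)) = of_nat n + 1 / finite_cf (butlast (r # qs))"
      using Cons by simp
    ultimately show ?thesis by (simp add: add_divide_distrib del: butlast.simps)
  qed simp
qed simp_all

section \<open>Recovering a column from its ratio\<close>

lemma coprime_fraction_multiple:
  fixes a c p r :: nat
  assumes "(of_nat a / of_nat c :: rat) = of_nat p / of_nat r"
    and "c \<noteq> 0" "r \<noteq> 0" "coprime p r"
  obtains g where "g \<noteq> 0" "a = g * p" "c = g * r"
proof -
  have "(of_nat (a * r) :: rat) = of_nat (p * c)"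
    using assms(1-3) by (simp add: field_simps)
  then have eq: "a * r = p * c" by (simp only: of_nat_eq_iff)
  \<comment> \<open>\<open>r\<close> divides \<open>p * c\<close> and is coprime to
    \<open>p\<close>; the quotient of \<open>c\<close> by \<open>r\<close> is the common factor
    sought.\<close>
  then have "r dvd c"
    by (metis assms(4) coprime_commute coprime_dvd_mult_right_iff dvd_triv_right)
  then obtain g where "c = g * r" by (metis dvd_div_mult_self)
  with eq assms that[of g] show thesis by auto
qed

lemma fraction_lowest_terms:
  assumes "y \<noteq> (0 :: nat)"
  obtains x' y' where "y' \<noteq> 0" "gcd x' y' = 1"
    "(of_nat x / of_nat y :: rat) = of_nat x' / of_nat y'"
proof -
  obtain x' y' where xy: "x = x' * gcd x y" "y = y' * gcd x y" "coprime x' y'"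
    using gcd_coprime_exists[of x y] assms by auto
  have "(of_nat x / of_nat y :: rat) = of_nat (x' * gcd x y) / of_nat (y' * gcd x y)"
    using xy by simp
  also have "\<dots> = of_nat x' / of_nat y'"
    using assms by simp
  finally show thesis
    using that[of y' x'] xy assms by (metis coprime_imp_gcd_eq_1 mult_0)
qed

text \<open>Reducing the tail to lowest terms keeps the ratio. Conversely, a coprime tail yields a
  coprime column, so (a, c) is a multiple of it, and scaling the tail by the same factor gives (a,
  c) exactly.\<close>

lemma finite_column_iff:
  assumes "qs \<noteq> []" "\<forall>n \<in> set (tl qs). n > 0" "c \<noteq> 0"
  shows "(\<exists>x y. y \<noteq> 0 \<and> cf_col qs (x, y) = (a, c)) \<longleftrightarrow>
    (\<exists>x y. y \<noteq> 0 \<and> gcd x y = 1 \<and>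
      (of_nat a / of_nat c :: rat) = num_cf qs (of_nat x / of_nat y))"
    (is "?L \<longleftrightarrow> ?R")
proof
  assume ?L
  then obtain x y where xy: "y \<noteq> 0" "cf_col qs (x, y) = (a, c)" by blast
  obtain x' y' where "y' \<noteq> 0" "gcd x' y' = 1"
    "(of_nat x / of_nat y :: rat) = of_nat x' / of_nat y'"
    by (rule fraction_lowest_terms[OF xy(1)])
  moreover have "(of_nat a / of_nat c :: rat) = num_cf qs (of_nat x / of_nat y)"
    using cf_col_ratio[OF assms(1,2), of "(x, y)"] xy by simp
  ultimately show ?R by auto
next
  assume ?R
  then obtain x y where xy: "y \<noteq> 0" "gcd x y = 1"
    "(of_nat a / of_nat c :: rat) = num_cf qs (of_nat x / of_nat y)" by auto
  obtain p r where pr: "cf_col qs (x, y) = (p, r)" by fastforce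
  have "r \<noteq> 0" "(of_nat a / of_nat c :: rat) = of_nat p / of_nat r"
    using cf_col_ratio[OF assms(1,2), of "(x, y)"] xy pr by simp_all
  moreover have "coprime p r"
    using gcd_cf_col[of qs "(x, y)"] xy pr by (simp add: coprime_iff_gcd_eq_1)
  ultimately obtain g where "g \<noteq> 0" "a = g * p" "c = g * r"
    using coprime_fraction_multiple assms(3) by metis
  then have "cf_col qs (g * x, g * y) = (a, c)" "g * y \<noteq> 0"
    using pr xy by (simp_all add: cf_col_scale)
  then show ?L by blast
qed

lemma infinite_column_iff:
  assumes "qs \<noteq> []" "\<forall>n \<in> set (tl qs). n > 0" "d \<noteq> 0"
  shows "(\<exists>x. cf_col qs (x, 0) = (b, d)) \<longleftrightarrow>
    length qs \<ge> 2 \<and> (of_nat b / of_nat d :: rat) = finite_cf (butlast qs)"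
    (is "?L \<longleftrightarrow> ?R")
proof
  assume ?L
  then obtain x where x: "cf_col qs (x, 0) = (b, d)" by blast
  \<comment> \<open>A single quotient leaves the lower entry 0, contradicting
    \<open>d \<noteq> 0\<close>.\<close>
  have len: "length qs \<ge> 2"
    using x assms by (cases qs rule: remdups_adj.cases) auto
  obtain p r where pr: "cf_col qs (1, 0) = (p, r)" by fastforce
  \<comment> \<open>Since \<open>d \<noteq> 0\<close>, the factor \<open>x\<close> is nonzero and
    cancels from the ratio.\<close>
  have "b = x * p" "d = x * r"
    using cf_col_scale[of qs x 1 0] x pr by simp_all
  with cf_col_infinity[OF len assms(2)] pr assms(3) len show ?R
    by simp
next
  assume R: ?R
  obtain p r where pr: "cf_col qs (1, 0) = (p, r)" by fastforce
  have "r \<noteq> 0" "(of_nat b / of_nat d :: rat) = of_nat p / of_nat r"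
    using cf_col_infinity[OF _ assms(2)] R pr by simp_all
  moreover have "coprime p r"
    using gcd_cf_col[of qs "(1, 0)"] pr by (simp add: coprime_iff_gcd_eq_1)
  ultimately obtain g where "b = g * p" "d = g * r"
    using coprime_fraction_multiple assms(3) by metis
  then have "cf_col qs (g, 0) = (b, d)"
    using cf_col_scale[of qs g 1 0] pr by simp
  then show ?L by blast
qed

section \<open>Row swaps and the alternating word\<close>

definition row_swap :: "nat^2^2" where "row_swap = mat2 0 1 1 0"

lemma plft_recip_eq: "plft_recip M = row_swap ** M"
  by (cases M rule: mat2_exhaust) (simp add: plft_recip_mat2 row_swap_def mat2_mult)

lemma row_swap_row_swap: "row_swap ** row_swap = mat 1"
  by (simp add: row_swap_def mat2_mult mat_1_eq_mat2 del: One_nat_def)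

lemma row_swap_cancel [simp]: "row_swap ** (row_swap ** M) = M"
  by (simp add: matrix_mul_assoc row_swap_row_swap del: One_nat_def)

text \<open>Stated by parity of the index, so that conjugation matches a shift of the index by
  one.\<close>

lemma mat_pow_conj_row_swap:
  "mat_pow (if odd i then R1 else L1) n =
     row_swap ** mat_pow (if even i then R1 else L1) n ** row_swap"
  by (simp add: mat_pow_R1 mat_pow_L1 row_swap_def mat2_mult)

text \<open>Inner swaps cancel in adjacent pairs; the empty product works because the swap is an
  involution.\<close>

lemma foldr_conj_row_swap:
  "foldr (**) (map (\<lambda>i. row_swap ** F i ** row_swap) is) (mat 1) =
     row_swap ** foldr (**) (map F is) (mat 1) ** row_swap"
  by (induction "is") (simp_all add: row_swap_row_swap del: One_nat_def flip: matrix_mul_assoc)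

text \<open>Splitting off the first factor shifts the remaining indices, which exchanges
  \<open>R1\<close> and \<open>L1\<close>; the conjugation corrects this.\<close>

lemma RL_word_Cons:
  "RL_word (n # qs) = mat_pow R1 n ** (row_swap ** RL_word qs ** row_swap)"
proof -
  have "[0..<length (n # qs)] = 0 # map Suc [0..<length qs]"
    by (simp add: upt_conv_Cons map_Suc_upt del: upt_Suc)
  then show ?thesis
    unfolding RL_word_def foldr_conj_row_swap[symmetric] mat_pow_conj_row_swap[symmetric]
    by (simp add: comp_def del: upt_Suc)
qed

text \<open>Each further quotient contributes one closing swap next to the tail: it either cancels
  the swap already there or becomes the leftover one.\<close>

lemma plft_cf_eq_RL_word:
  assumes "qs \<noteq> []"
  shows "plft_cf qs M = RL_word qs ** (if odd (length qs) then M else plft_recip M)"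
  using assms
proof (induction qs M rule: plft_cf.induct)
  case (2 n M)
  have "RL_word [n] = mat_pow R1 n"
    by (simp add: RL_word_def del: One_nat_def)
  then show ?case by (simp add: plft_add_def)
next
  case (3 n r qs M)
  then show ?case
    by (simp add: RL_word_Cons[of n] plft_add_def plft_recip_eq flip: matrix_mul_assoc)
qed simp

theorem theorem3p3:
  fixes a b c d k :: nat and q :: "nat \<Rightarrow> nat"
  assumes "plft (mat2 a b c d)" and "c \<noteq> 0" and "d \<noteq> 0"
    and "k \<ge> 1" and "\<And>i. 1 \<le> i \<Longrightarrow> i < k \<Longrightarrow> q i > 0"
  defines "A \<equiv> \<exists>a' b' c' d'. plft (mat2 a' b' c' d') \<and> c' \<noteq> 0 \<and>
                 mat2 a b c d = plft_cf (map q [0..<k]) (mat2 a' b' c' d')"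
    and "B \<equiv> (\<exists>a'' c''. c'' \<noteq> 0 \<and> gcd a'' c'' = 1 \<and>
                 (of_nat a / of_nat c :: rat) =
                   num_cf (map q [0..<k]) (of_nat a'' / of_nat c'')) \<and>
             ((\<exists>b'' d''. d'' \<noteq> 0 \<and> gcd b'' d'' = 1 \<and>
                 (of_nat b / of_nat d :: rat) =
                   num_cf (map q [0..<k]) (of_nat b'' / of_nat d'')) \<or>
              (k \<ge> 2 \<and> (of_nat b / of_nat d :: rat) = finite_cf (map q [0..<k - 1])))"
    and "C \<equiv> \<exists>a' b' c' d'. plft (mat2 a' b' c' d') \<and>
                 (if odd k then c' \<noteq> 0 else a' \<noteq> 0) \<and>
                 mat2 a b c d = RL_word (map q [0..<k]) ** mat2 a' b' c' d'"
  shows "(A \<longleftrightarrow> B) \<and> (B \<longleftrightarrow> C)"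
proof -
  define qs where "qs = map q [0..<k]"
  have len: "length qs = k" and ne: "qs \<noteq> []"
    using \<open>k \<ge> 1\<close> by (auto simp: qs_def)
  have "tl qs = map q [1..<k]"
    by (simp add: qs_def map_tl[symmetric])
  then have pos: "\<forall>n \<in> set (tl qs). n > 0"
    using assms(5) by auto
  have butlast: "butlast qs = map q [0..<k - 1]"
    using \<open>k \<ge> 1\<close> by (cases k) (simp_all add: qs_def)

  \<comment> \<open>The tail inherits the nonzero determinant of the given matrix, so its two
    columns can be chosen independently.\<close>
  have tail_plft: "plft (mat2 a' b' c' d')"
    if "mat2 a b c d = plft_cf qs (mat2 a' b' c' d')" for a' b' c' d'
    using that assms(1) plft_plft_cf by metis
  have "A \<longleftrightarrow> (\<exists>a' b' c' d'. c' \<noteq> 0 \<and> mat2 a b c d = plft_cf qs (mat2 a' b' c' d'))"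
    unfolding A_def qs_def[symmetric] using tail_plft by blast
  also have "\<dots> \<longleftrightarrow> (\<exists>x y. y \<noteq> 0 \<and> cf_col qs (x, y) = (a, c)) \<and> (\<exists>x y. cf_col qs (x, y) = (b, d))"
    by (auto simp: plft_cf_mat2 prod_eq_iff)
  \<comment> \<open>Only the first column has its lower entry required to be nonzero; a zero lower
    entry in the second gives the exceptional alternative of \<open>B\<close>.\<close>
  also have "(\<exists>x y. cf_col qs (x, y) = (b, d)) \<longleftrightarrow>
      (\<exists>x y. y \<noteq> 0 \<and> cf_col qs (x, y) = (b, d)) \<or> (\<exists>x. cf_col qs (x, 0) = (b, d))"
    by metis
  finally have AB: "A \<longleftrightarrow> B"
    unfolding B_def qs_def[symmetric] butlast[symmetric]
      finite_column_iff[OF ne pos \<open>c \<noteq> 0\<close>] finite_column_iff[OF ne pos \<open>d \<noteq> 0\<close>]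
      infinite_column_iff[OF ne pos \<open>d \<noteq> 0\<close>] len .

  have "A \<longleftrightarrow> C"
  proof (cases "odd k")
    case True
    then show ?thesis
      unfolding A_def C_def qs_def[symmetric] by (simp add: plft_cf_eq_RL_word[OF ne] len)
  next
    case False
    have swap: "plft (mat2 c' d' a' b') \<longleftrightarrow> plft (mat2 a' b' c' d')" for a' b' c' d'
      by (auto simp: plft_mat2 mult.commute)
    \<comment> \<open>The leftover swap moves the lower left entry of the tail to the upper left,
      where \<open>C\<close> requires a nonzero entry for even \<open>k\<close>.\<close>
    from False have "A \<longleftrightarrow> (\<exists>a' b' c' d'. plft (mat2 c' d' a' b') \<and> c' \<noteq> 0 \<and>
        mat2 a b c d = RL_word qs ** mat2 c' d' a' b')"
      unfolding A_def qs_def[symmetric]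
      by (simp add: plft_cf_eq_RL_word[OF ne] len plft_recip_mat2 swap)
    with False show ?thesis
      unfolding C_def qs_def[symmetric] by auto
  qed
  with AB show ?thesis by blast
qed

end
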